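(* Fix $1<p<\infty$ and let $q$ be defined by $1/p+1/q=1$. Let $G$ be a commutative group, $U\subset G$ a $d$-dimensional quasicube and $V\subset U$. Then \[ \beta_p(V)\ge c_p^d\,|V|,\qquad\text{where } c_p=\frac{p^{1/p}q^{1/q}}{2}\le 1. \]
   Context: All groups are commutative and written additively. For a finite $U\subset G$ and $1<p<\infty$, $\beta_p(U)=\inf_{A,B}\frac{|A+B+U|}{|A|^{1/p}|B|^{1-1/p}}$, the infimum over all nonempty finite $A,B\subset G$. Quasicubes are defined recursively: a $0$-dimensional quasicube is any singleton; a finite set $U\subset G$ is a $d$-dimensional quasicube ($d\ge1$) if there is a proper subgroup $G'$ of $G$ and two distinct cosets $G'+x$, $G'+y$ such that $U\subset (G'+x)\cup(G'+y)$, both $U\cap(G'+x)$ and $U\cap(G'+y)$ are $(d-1)$-dimensional quasicubes, and $x-y$ has infinite order in $G/G'$. *)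

theory Defs
  imports Complex_Main
begin

definition sumset :: "'a::ab_group_add set \<Rightarrow> 'a set \<Rightarrow> 'a set" where
  "sumset A B = {a + b | a b. a \<in> A \<and> b \<in> B}"

definition beta :: "real \<Rightarrow> 'a::ab_group_add set \<Rightarrow> real" where
  "beta p U = Inf {real (card (sumset (sumset A B) U)) /
                    (real (card A) powr (1 / p) * real (card B) powr (1 - 1 / p)) | A B.
                   finite A \<and> A \<noteq> {} \<and> finite B \<and> B \<noteq> {}}"

definition is_subgroup :: "'a::ab_group_add set \<Rightarrow> bool" where
  "is_subgroup H \<longleftrightarrow> 0 \<in> H \<and> (\<forall>x\<in>H. \<forall>y\<in>H. x - y \<in> H)"

definition coset :: "'a::ab_group_add set \<Rightarrow> 'a \<Rightarrow> 'a set" where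
  "coset H x = (\<lambda>h. h + x) ` H"

definition nsmul :: "nat \<Rightarrow> 'a::ab_group_add \<Rightarrow> 'a" where
  "nsmul n x = (((+) x) ^^ n) 0"

inductive quasicube :: "nat \<Rightarrow> 'a::ab_group_add set \<Rightarrow> bool" where
  zero: "quasicube 0 {a}"
| step: "\<lbrakk> is_subgroup H; H \<noteq> UNIV; coset H x \<noteq> coset H y;
           U \<subseteq> coset H x \<union> coset H y;
           quasicube d (U \<inter> coset H x); quasicube d (U \<inter> coset H y);
           \<forall>n>0. nsmul n (x - y) \<notin> H \<rbrakk> \<Longrightarrow> quasicube (Suc d) U"

end

theory Submission
  imports Defs "HOL-Analysis.Analysis"
begin

text \<open>
  By induction on the dimension it suffices to show that, if \<open>V0\<close> and \<open>V1\<close> lie in two cosets of \<open>H\<close>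
  whose difference \<open>u\<close> has infinite order modulo \<open>H\<close>, then the best constant of \<open>V0 \<union> V1\<close> is at
  least \<open>c\<close> times the sum of the constants \<open>\<gamma>0 \<ge> \<gamma>1\<close> of \<open>V0\<close> and \<open>V1\<close>, where \<open>c\<close> is
  the constant \<open>c_p\<close> of the theorem.
  One may assume that \<open>A\<close> and \<open>B\<close> lie in cosets of the subgroup generated by \<open>H\<close> and \<open>u\<close>. Slicing by
  cosets of \<open>H\<close>, with \<open>f\<close>, \<open>g\<close> the slice sizes of \<open>A\<close>, \<open>B\<close> and \<open>\<delta> = \<gamma>1 / \<gamma>0\<close>, this becomes a
  weighted discrete Prekopa-Leindler inequality on the integers: if \<open>w (i + j)\<close> and
  \<open>w (i + j + 1) / \<delta>\<close> dominate \<open>f i powr (1/p) * g j powr (1/q)\<close>, then the sum of \<open>w\<close> is at least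
  \<open>c * (1 + \<delta>)\<close> times the product of the norms.

  For the latter, replace every integer by \<open>N\<close> points carrying the weights \<open>\<delta> powr (i / N)\<close>,
  \<open>i < N\<close> (raised to the powers \<open>p\<close> and \<open>q\<close> for \<open>f\<close> and \<open>g\<close>): a carry in the addition costs
  exactly one factor \<open>\<delta>\<close>. Applying \<open>|X + Y| \<ge> |X| + |Y| - 1\<close> to superlevel sets, letting \<open>N\<close> tend to
  infinity and using Young's inequality, one is left with an inequality in \<open>\<delta>\<close>, which for
  \<open>\<delta> = exp (-2 t)\<close> is Jensen's inequality for the convex function \<open>ln (sinh s / s)\<close> at the points
  \<open>p * t\<close> and \<open>q * t\<close> with weights \<open>1/p\<close> and \<open>1/q\<close>, whose mean is \<open>2 * t\<close>.
\<close>

section \<open>A weighted discrete Prekopa-Leindler inequality\<close>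

text \<open>The translates of \<open>A\<close> by \<open>Min B\<close> and of \<open>B\<close> by
  \<open>Max A\<close> both lie in \<open>C\<close> and share at most the point
  \<open>Max A + Min B\<close>.\<close>

lemma card_int_sumset_ge:
  fixes A B C :: "int set"
  assumes "finite A" "finite B" "finite C" "A \<noteq> {}" "B \<noteq> {}"
    and sub: "\<And>a b. a \<in> A \<Longrightarrow> b \<in> B \<Longrightarrow> a + b \<in> C"
  shows "card A + card B \<le> card C + 1"
proof -
  define X where "X = (\<lambda>a. a + Min B) ` A"
  define Y where "Y = (\<lambda>b. Max A + b) ` B"
  have "card X = card A" "card Y = card B"
    unfolding X_def Y_def by (auto intro!: card_image inj_onI)
  moreover have "X \<union> Y \<subseteq> C"
    using assms(1-5) unfolding X_def Y_def by (intro Un_least image_subsetI sub Min_in Max_in)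
  then have "card (X \<union> Y) \<le> card C"
    using assms by (intro card_mono)
  moreover have "X \<inter> Y \<subseteq> {Max A + Min B}"
  proof
    fix z assume "z \<in> X \<inter> Y"
    then obtain a b where "a \<in> A" "b \<in> B" "z = a + Min B" "z = Max A + b"
      unfolding X_def Y_def by auto
    moreover from this have "a \<le> Max A" "Min B \<le> b" using assms by auto
    ultimately show "z \<in> {Max A + Min B}" by auto
  qed
  then have "card (X \<inter> Y) \<le> card {Max A + Min B}"
    by (intro card_mono) auto
  then have "card (X \<inter> Y) \<le> 1" by simp
  moreover have "card X + card Y = card (X \<union> Y) + card (X \<inter> Y)"
    using assms unfolding X_def Y_def by (intro card_Un_Int) auto
  ultimately show ?thesis by linarith
qed

text \<open>Layer-cake formula: over \<open>{0..1}\<close> the indicator of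
  \<open>t \<le> f i\<close> integrates to \<open>min 1 (f i)\<close>.\<close>

lemma has_integral_card_superlevel:
  fixes f :: "'i \<Rightarrow> real"
  assumes "finite I" "\<And>i. i \<in> I \<Longrightarrow> 0 \<le> f i"
  shows "((\<lambda>t. real (card {i \<in> I. t \<le> f i})) has_integral (\<Sum>i\<in>I. min 1 (f i))) {0..1}"
proof -
  have "((\<lambda>t::real. if t \<in> {0..min 1 c} then 1 else (0::real)) has_integral (min 1 c)) {0..1}"
    if "0 \<le> c" for c
    using that has_integral_const_real[of "1::real" 0 "min 1 c"]
    by (subst has_integral_restrict) auto
  from has_integral_eq[OF _ this]
  have "((\<lambda>t::real. if t \<le> c then 1 else (0::real)) has_integral (min 1 c)) {0..1}"
    if "0 \<le> c" for c
    using that by (auto simp: min_def split: if_splits)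
  then have "((\<lambda>t. \<Sum>i\<in>I. if t \<le> f i then 1 else (0::real)) has_integral (\<Sum>i\<in>I. min 1 (f i))) {0..1}"
    using assms by (intro has_integral_sum) auto
  moreover have "(\<Sum>i\<in>I. if t \<le> f i then 1 else (0::real)) = real (card {i \<in> I. t \<le> f i})" for t
    using assms(1) by (simp add: sum.If_cases Int_def)
  ultimately show ?thesis by simp
qed

text \<open>For \<open>t\<close> in \<open>{0..1}\<close> the superlevel sets of \<open>f\<close>
  and \<open>g\<close> are nonempty, since both functions attain 1, so
  \<open>card_int_sumset_ge\<close> applies at each level; then integrate over \<open>t\<close>. As
  \<open>h\<close> may exceed 1, its integral is a truncated sum first.\<close>

lemma discrete_prekopa_leindler:
  fixes f g h :: "int \<Rightarrow> real"
  assumes fin: "finite I" "finite J" "finite K"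
    and f: "\<And>i. i \<in> I \<Longrightarrow> 0 \<le> f i \<and> f i \<le> 1" "a \<in> I" "f a = 1"
    and g: "\<And>j. j \<in> J \<Longrightarrow> 0 \<le> g j \<and> g j \<le> 1" "b \<in> J" "g b = 1"
    and h: "\<And>k. k \<in> K \<Longrightarrow> 0 \<le> h k"
    and sub: "\<And>i j. i \<in> I \<Longrightarrow> j \<in> J \<Longrightarrow> i + j \<in> K \<and> min (f i) (g j) \<le> h (i + j)"
  shows "sum f I + sum g J - 1 \<le> sum h K"
proof -
  have eq: "(\<Sum>i\<in>I. min 1 (f i)) = sum f I" "(\<Sum>j\<in>J. min 1 (g j)) = sum g J"
    using f g by (auto intro!: sum.cong)
  have "((\<lambda>t. real (card {i \<in> I. t \<le> f i}) + real (card {j \<in> J. t \<le> g j}) - 1)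
      has_integral (sum f I + sum g J - 1)) {0..1}"
    using has_integral_card_superlevel[OF fin(1), of f] has_integral_card_superlevel[OF fin(2), of g]
      f g has_integral_const_real[of "1::real" 0 1] unfolding eq
    by (intro has_integral_diff has_integral_add) auto
  moreover have "((\<lambda>t. real (card {k \<in> K. t \<le> h k})) has_integral (\<Sum>k\<in>K. min 1 (h k))) {0..1}"
    using has_integral_card_superlevel[OF fin(3)] h by blast
  moreover have "real (card {i \<in> I. t \<le> f i}) + real (card {j \<in> J. t \<le> g j}) - 1
      \<le> real (card {k \<in> K. t \<le> h k})" if "t \<in> {0..1}" for t
  proof -
    have "card {i \<in> I. t \<le> f i} + card {j \<in> J. t \<le> g j} \<le> card {k \<in> K. t \<le> h k} + 1"
    proof (rule card_int_sumset_ge)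
      show "{i \<in> I. t \<le> f i} \<noteq> {}" "{j \<in> J. t \<le> g j} \<noteq> {}" using f g that by auto
      fix i j assume "i \<in> {i \<in> I. t \<le> f i}" "j \<in> {j \<in> J. t \<le> g j}"
      then show "i + j \<in> {k \<in> K. t \<le> h k}" using sub[of i j] by auto
    qed (use fin in auto)
    then show ?thesis by linarith
  qed
  ultimately have "sum f I + sum g J - 1 \<le> (\<Sum>k\<in>K. min 1 (h k))"
    by (rule has_integral_le)
  also have "\<dots> \<le> sum h K" by (intro sum_mono) auto
  finally show ?thesis .
qed

text \<open>Lets hypotheses with geometric means feed \<open>discrete_prekopa_leindler\<close>,
  which asks for a minimum.\<close>

lemma min_le_weighted_geometric_mean:
  fixes x y \<alpha> \<beta> :: real
  assumes "0 \<le> x" "0 \<le> y" "0 \<le> \<alpha>" "0 \<le> \<beta>" "\<alpha> + \<beta> = 1"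
  shows "min x y \<le> x powr \<alpha> * y powr \<beta>"
proof -
  have "min x y = min x y powr \<alpha> * min x y powr \<beta>"
    using assms by (simp flip: powr_add)
  also have "\<dots> \<le> x powr \<alpha> * y powr \<beta>"
    using assms by (intro mult_mono powr_mono2) auto
  finally show ?thesis .
qed

section \<open>Block subdivision of the integers and limits of exponential averages\<close>

lemma sum_blocks:
  fixes u v :: "int \<Rightarrow> real" and N :: nat
  assumes "finite I" "0 < N"
  shows "(\<Sum>k | k div int N \<in> I. u (k div int N) * v (k mod int N)) = sum u I * (\<Sum>i<N. v (int i))"
    and "finite {k. k div int N \<in> I}"
proof -
  have "sum u I * (\<Sum>i<N. v (int i)) = (\<Sum>(n, i)\<in>I \<times> {..<N}. u n * v (int i))"
    by (simp add: sum_product sum.cartesian_product)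
  also have "\<dots> = (\<Sum>k | k div int N \<in> I. u (k div int N) * v (k mod int N))"
    using assms
    by (intro sum.reindex_bij_witness[where i = "\<lambda>k. (k div int N, nat (k mod int N))"
          and j = "\<lambda>(n, i). n * int N + int i"]) (auto simp: nat_less_iff)
  finally show "(\<Sum>k | k div int N \<in> I. u (k div int N) * v (k mod int N)) = sum u I * (\<Sum>i<N. v (int i))" ..
  have "{k. k div int N \<in> I} \<subseteq> (\<lambda>(n, i). n * int N + i) ` (I \<times> {0..<int N})"
  proof
    fix k assume "k \<in> {k. k div int N \<in> I}"
    then have "(k div int N, k mod int N) \<in> I \<times> {0..<int N}"
      using assms by auto
    moreover have "k = (\<lambda>(n, i). n * int N + i) (k div int N, k mod int N)" by simp
    ultimately show "k \<in> (\<lambda>(n, i). n * int N + i) ` (I \<times> {0..<int N})" by blast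
  qed
  then show "finite {k. k div int N \<in> I}"
    using assms(1) by (meson finite_subset finite_imageI finite_SigmaI finite_atLeastLessThan_int)
qed

text \<open>The mean value of \<open>exp (c * x)\<close> over \<open>0 \<le> x \<le> 1\<close>.\<close>
definition exp_mean :: "real \<Rightarrow> real" where
  "exp_mean c = (if c = 0 then 1 else (exp c - 1) / c)"

text \<open>For \<open>c \<noteq> 0\<close> the sum is geometric with ratio
  \<open>exp (c / N)\<close>, so the claim reduces to \<open>(exp y - 1) / y\<close> tending to 1 as
  \<open>y\<close> tends to 0.\<close>

lemma exp_mean_LIMSEQ:
  "(\<lambda>N. (\<Sum>i<N. exp (c * (real i / real N))) / real N) \<longlonglongrightarrow> exp_mean c"
proof (cases "c = 0")
  case True
  have "eventually (\<lambda>N. (\<Sum>i<N. exp (c * (real i / real N))) / real N = exp_mean c) sequentially"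
    using eventually_gt_at_top[of 0] by eventually_elim (simp add: True exp_mean_def)
  then show ?thesis by (simp add: tendsto_eventually)
next
  case False
  have "filterlim (\<lambda>N. c / real N) (at 0) sequentially"
    unfolding filterlim_at
  proof
    show "eventually (\<lambda>N. c / real N \<in> UNIV \<and> c / real N \<noteq> 0) sequentially"
      using eventually_gt_at_top[of 0] by eventually_elim (simp add: False)
    show "(\<lambda>N. c / real N) \<longlonglongrightarrow> 0" by (rule lim_const_over_n)
  qed
  from filterlim_compose[OF lim_exp_minus_1 this]
  have "(\<lambda>N. (exp (c / real N) - 1) / (c / real N)) \<longlonglongrightarrow> 1" .
  then have "(\<lambda>N. ((exp c - 1) / c) / ((exp (c / real N) - 1) / (c / real N))) \<longlonglongrightarrow> ((exp c - 1) / c) / 1"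
    by (intro tendsto_intros) auto
  then have *: "(\<lambda>N. ((exp c - 1) / c) / ((exp (c / real N) - 1) / (c / real N))) \<longlonglongrightarrow> exp_mean c"
    using False by (simp add: exp_mean_def)
  show ?thesis
  proof (rule Lim_transform_eventually[OF *])
    show "eventually (\<lambda>N. ((exp c - 1) / c) / ((exp (c / real N) - 1) / (c / real N))
        = (\<Sum>i<N. exp (c * (real i / real N))) / real N) sequentially"
      using eventually_gt_at_top[of 0]
    proof eventually_elim
      case (elim N)
      have ne: "exp (c / real N) \<noteq> 1" using False elim by simp
      have "(\<Sum>i<N. exp (c * (real i / real N))) = (\<Sum>i<N. exp (c / real N) ^ i)"
        by (intro sum.cong) (auto simp: exp_of_nat_mult[symmetric] mult.commute)
      also have "\<dots> = (exp (c / real N) ^ N - 1) / (exp (c / real N) - 1)"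
        using ne by (simp add: geometric_sum)
      also have "exp (c / real N) ^ N = exp c"
        using elim by (simp add: exp_of_nat_mult[symmetric])
      finally have "(\<Sum>i<N. exp (c * (real i / real N))) = (exp c - 1) / (exp (c / real N) - 1)" .
      then show ?case using False elim ne by simp
    qed
  qed
qed

section \<open>Convexity of \<open>ln (sinh s / s)\<close> and the inequality for exponential
  means\<close>

lemma sinh_real_ge_self:
  fixes s :: real
  assumes "0 \<le> s"
  shows "s \<le> sinh s"
proof -
  have "\<exists>D. ((\<lambda>x. sinh x - x) has_real_derivative D) (at x) \<and> 0 \<le> D" for x :: real
    by (rule exI[of _ "cosh x - 1"]) (auto intro!: derivative_eq_intros simp: cosh_real_ge_1)
  then have "sinh 0 - 0 \<le> sinh s - s"
    using DERIV_nonneg_imp_nondecreasing[OF assms, of "\<lambda>x. sinh x - x"] by blast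
  then show ?thesis by simp
qed

text \<open>The second derivative \<open>1 / x^2 - 1 / (sinh x)^2\<close> is nonnegative because
  \<open>x \<le> sinh x\<close>.\<close>

lemma convex_on_ln_sinh_div: "convex_on {0<..} (\<lambda>s::real. ln (sinh s / s))"
proof (rule f''_ge0_imp_convex)
  show "convex {0::real<..}" by simp
next
  fix x :: real assume "x \<in> {0<..}"
  then have x: "0 < x" "0 < sinh x" by auto
  show "((\<lambda>s. ln (sinh s / s)) has_real_derivative (cosh x / sinh x - 1 / x)) (at x)"
    using x by (auto intro!: derivative_eq_intros simp: field_simps power2_eq_square)
  have "cosh x * cosh x = sinh x * sinh x + 1"
    using cosh_square_eq[of x] by (simp add: power2_eq_square)
  then show "((\<lambda>x. cosh x / sinh x - 1 / x) has_real_derivative (1 / x\<^sup>2 - 1 / (sinh x)\<^sup>2)) (at x)"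
    using x by (auto intro!: derivative_eq_intros simp: field_simps power2_eq_square)
  have "x\<^sup>2 \<le> (sinh x)\<^sup>2" using sinh_real_ge_self[of x] x by (intro power_mono) auto
  then show "0 \<le> 1 / x\<^sup>2 - 1 / (sinh x)\<^sup>2"
    using x by (simp add: frac_le)
qed

lemma exp_mean_eq_sinh:
  assumes "0 < s"
  shows "exp_mean (- 2 * s) = exp (- s) * (sinh s / s)"
  using assms by (simp add: exp_mean_def sinh_field_def field_simps flip: exp_add)

lemma exp_mean_pos: "0 < exp_mean c"
  by (auto simp: exp_mean_def zero_less_divide_iff)

text \<open>Put \<open>S s = sinh s / s\<close>. By
  \<open>sinh (2 * t) = 2 * sinh t * cosh t\<close> the left side is
  \<open>exp (- 2 * t) * S (2 * t)\<close> for \<open>t > 0\<close>; the right side is the same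
  exponential times the weighted geometric mean of \<open>S (p * t)\<close> and
  \<open>S (q * t)\<close>. Jensen applies since
  \<open>1 / p * (p * t) + 1 / q * (q * t) = 2 * t\<close>.\<close>

lemma exp_mean_inequality:
  fixes p q t :: real
  assumes "1 < p" "1 < q" "1 / p + 1 / q = 1" "0 \<le> t"
  shows "(1 + exp (- 2 * t)) / 2 * exp_mean (- 2 * t)
    \<le> exp_mean (p * (- 2 * t)) powr (1 / p) * exp_mean (q * (- 2 * t)) powr (1 / q)"
proof (cases "t = 0")
  case True
  then show ?thesis by (simp add: exp_mean_def)
next
  case False
  with assms have t: "0 < t" by simp
  define S :: "real \<Rightarrow> real" where "S = (\<lambda>s. sinh s / s)"
  have S: "0 < S s" if "0 < s" for s using that by (simp add: S_def)
  have pos: "0 < p * t" "0 < q * t" "0 < 2 * t" using t assms by auto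
  have *: "exp_mean (r * (- 2 * t)) powr (1 / r) = exp (- t) * S (r * t) powr (1 / r)"
    if "0 < r" for r
  proof -
    have "exp_mean (r * (- 2 * t)) = exp (- (r * t)) * S (r * t)"
      using exp_mean_eq_sinh[of "r * t"] that t by (simp add: S_def ac_simps)
    moreover have "exp (- (r * t)) powr (1 / r) = exp (- t)" using that by (simp add: powr_def)
    ultimately show ?thesis using that t S[of "r * t"] by (simp add: powr_mult)
  qed
  have "(1 + exp (- 2 * t)) / 2 * exp_mean (- 2 * t) = exp (- t) * exp (- t) * S (2 * t)"
    unfolding exp_mean_eq_sinh[OF t] S_def using t
    by (simp add: sinh_field_def field_simps flip: exp_add)
  also have "S (2 * t) \<le> S (p * t) powr (1 / p) * S (q * t) powr (1 / q)"
  proof -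
    have "ln (S ((1 / p) *\<^sub>R (p * t) + (1 / q) *\<^sub>R (q * t)))
        \<le> 1 / p * ln (S (p * t)) + 1 / q * ln (S (q * t))"
      using convex_on_ln_sinh_div[unfolded convex_on_def, THEN conjunct2, rule_format,
          of "p * t" "q * t" "1 / p" "1 / q"] pos assms(1-3)
      by (simp only: S_def greaterThan_iff zero_le_divide_1_iff)
    moreover have "(1 / p) *\<^sub>R (p * t) + (1 / q) *\<^sub>R (q * t) = 2 * t" using assms by simp
    ultimately have "ln (S (2 * t)) \<le> ln (S (p * t) powr (1 / p) * S (q * t) powr (1 / q))"
      using S[OF pos(1)] S[OF pos(2)] by (simp add: ln_mult ln_powr)
    then show ?thesis using S[OF pos(1)] S[OF pos(2)] S[OF pos(3)] by simp
  qed
  finally show ?thesis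
    using *[of p] *[of q] assms by (simp add: ac_simps)
qed

section \<open>The weighted inequality on the integers\<close>

text \<open>Maxima equal to 1 are what \<open>discrete_prekopa_leindler\<close> requires; the 1
  subtracted there disappears when the block inequality is divided by \<open>N\<close> and
  \<open>N\<close> tends to infinity.\<close>

lemma weighted_prekopa_leindler_normalised:
  fixes f g w :: "int \<Rightarrow> real" and p q \<delta> :: real
  assumes pq: "1 < p" "1 < q" "1 / p + 1 / q = 1" and \<delta>: "0 < \<delta>" "\<delta> \<le> 1"
    and fin: "finite I" "finite J" "finite K"
    and f: "\<And>i. i \<in> I \<Longrightarrow> 0 \<le> f i \<and> f i \<le> 1" "a \<in> I" "f a = 1"
    and g: "\<And>j. j \<in> J \<Longrightarrow> 0 \<le> g j \<and> g j \<le> 1" "b \<in> J" "g b = 1"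
    and w: "\<And>k. k \<in> K \<Longrightarrow> 0 \<le> w k"
    and w0: "\<And>i j. i \<in> I \<Longrightarrow> j \<in> J \<Longrightarrow>
      i + j \<in> K \<and> f i powr (1 / p) * g j powr (1 / q) \<le> w (i + j)"
    and w1: "\<And>i j. i \<in> I \<Longrightarrow> j \<in> J \<Longrightarrow>
      i + j + 1 \<in> K \<and> \<delta> * (f i powr (1 / p) * g j powr (1 / q)) \<le> w (i + j + 1)"
  shows "p powr (1 / p) * q powr (1 / q) / 2 * (1 + \<delta>) *
      (sum f I powr (1 / p) * sum g J powr (1 / q)) \<le> sum w K"
proof -
  \<comment> \<open>Chosen so that \<open>\<delta> = exp (- 2 * t)\<close>, the parametrisation of
    \<open>exp_mean_inequality\<close>.\<close>
  define t where "t = - ln \<delta> / 2"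
  have t: "0 \<le> t" "\<delta> = exp (- 2 * t)" using \<delta> by (auto simp: t_def)
  \<comment> \<open>\<open>e r N i\<close> is \<open>\<delta> powr (r * i / N)\<close>. With
    \<open>r = p\<close> for \<open>f\<close>, \<open>r = q\<close> for \<open>g\<close> and
    \<open>r = 1\<close> for \<open>w\<close>, the powers \<open>1 / p\<close> and
    \<open>1 / q\<close> turn the first two weights into \<open>e 1 N\<close>.\<close>
  define e where "e = (\<lambda>r (N::nat) i::int. exp (r * (- 2 * t) * (real_of_int i / real N)))"
  define s where "s = (\<lambda>r N. \<Sum>i<N. exp (r * (- 2 * t) * (real i / real N)))"
  have s: "(\<Sum>i<N. e r N (int i)) = s r N" for r N by (simp add: e_def s_def)
  have block: "sum f I * s p N + sum g J * s q N - 1 \<le> sum w K * s 1 N" if N: "0 < N" for N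
  proof -
    let ?B = "\<lambda>I. {k. k div int N \<in> I}"
    define F where "F = (\<lambda>r f k. f (k div int N) * e r N (k mod int N))"
    have sumF: "sum (F r f) (?B I) = sum f I * s r N" if "finite I" for r f I
      using sum_blocks(1)[OF that N, of f "e r N"] by (simp add: F_def s)
    have e_pos: "0 < e r N i" for r i by (simp add: e_def)
    have e_le: "e r N i \<le> 1" if "0 \<le> i" "0 < r" for r i
      using that t N by (simp add: e_def mult_nonneg_nonneg divide_nonneg_nonneg)
    have e_powr: "e r N i powr (1 / r) = e 1 N i" if "0 < r" for r i
      using that by (simp add: e_def powr_def)
    have "sum (F p f) (?B I) + sum (F q g) (?B J) - 1 \<le> sum (F 1 w) (?B K)"
    proof (rule discrete_prekopa_leindler)
      show "0 \<le> F p f i \<and> F p f i \<le> 1" if "i \<in> ?B I" for i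
        using f(1)[of "i div int N"] that e_pos[of p] e_le[of "i mod int N" p] pq N
        by (auto simp: F_def less_imp_le intro!: mult_le_one)
      show "0 \<le> F q g i \<and> F q g i \<le> 1" if "i \<in> ?B J" for i
        using g(1)[of "i div int N"] that e_pos[of q] e_le[of "i mod int N" q] pq N
        by (auto simp: F_def less_imp_le intro!: mult_le_one)
      \<comment> \<open>The left end of a block has residue 0, hence weight 1, so the maximum 1 is
        still attained.\<close>
      show "a * int N \<in> ?B I" "F p f (a * int N) = 1" "b * int N \<in> ?B J" "F q g (b * int N) = 1"
        using N f g by (auto simp: F_def e_def)
      show "0 \<le> F 1 w k" if "k \<in> ?B K" for k
        using that w e_pos[of 1] by (simp add: F_def less_imp_le)
      fix i j assume i: "i \<in> ?B I" and j: "j \<in> ?B J"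
      let ?i = "i div int N" and ?j = "j div int N" and ?i' = "i mod int N" and ?j' = "j mod int N"
      have ij: "i + j = (?i + ?j) * int N + (?i' + ?j')" by (simp add: algebra_simps)
      have qr: "(c * int N + r) div int N = c \<and> (c * int N + r) mod int N = r"
        if "0 \<le> r" "r < int N" for c r
        using that by simp
      have bounds: "0 \<le> ?i'" "?i' < int N" "0 \<le> ?j'" "?j' < int N" using N by auto
      have "min (F p f i) (F q g j) \<le> F p f i powr (1 / p) * F q g j powr (1 / q)"
        using f(1) g(1) i j pq e_pos[of p] e_pos[of q]
        by (intro min_le_weighted_geometric_mean) (auto simp: F_def less_imp_le)
      also have "\<dots> = (f ?i powr (1 / p) * g ?j powr (1 / q)) * (e 1 N ?i' * e 1 N ?j')"
        using f(1) g(1) i j pq e_pos[of p] e_pos[of q]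
        by (simp add: F_def powr_mult e_powr less_imp_le)
      also have "e 1 N ?i' * e 1 N ?j' = e 1 N (?i' + ?j')"
        by (simp add: e_def add_divide_distrib algebra_simps flip: exp_add)
      finally have le: "min (F p f i) (F q g j) \<le> f ?i powr (1 / p) * g ?j powr (1 / q) * e 1 N (?i' + ?j')" .
      show "i + j \<in> ?B K \<and> min (F p f i) (F q g j) \<le> F 1 w (i + j)"
      \<comment> \<open>Without a carry the sum lands in block \<open>?i + ?j\<close>, governed by
        \<open>w0\<close>; with a carry it lands in block \<open>?i + ?j + 1\<close>, governed by
        \<open>w1\<close>.\<close>
      proof (cases "?i' + ?j' < int N")
        case True
        have dm: "(i + j) div int N = ?i + ?j" "(i + j) mod int N = ?i' + ?j'"
          using qr[of "?i' + ?j'" "?i + ?j"] True bounds unfolding ij[symmetric] by auto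
        have "f ?i powr (1 / p) * g ?j powr (1 / q) * e 1 N (?i' + ?j') \<le> w (?i + ?j) * e 1 N (?i' + ?j')"
          using w0[of ?i ?j] i j e_pos[of 1] by (intro mult_right_mono) (auto simp: less_imp_le)
        with le dm w0[of ?i ?j] i j show ?thesis by (simp add: F_def)
      next
        case False
        have ij': "i + j = (?i + ?j + 1) * int N + (?i' + ?j' - int N)"
          using ij by (simp add: algebra_simps)
        have dm: "(i + j) div int N = ?i + ?j + 1" "(i + j) mod int N = ?i' + ?j' - int N"
          using qr[of "?i' + ?j' - int N" "?i + ?j + 1"] False bounds unfolding ij'[symmetric] by auto
        \<comment> \<open>The carry lowers the residue by \<open>N\<close>, which releases exactly
          the factor \<open>\<delta>\<close> of \<open>w1\<close>.\<close>
        have "e 1 N (?i' + ?j') = \<delta> * e 1 N (?i' + ?j' - int N)"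
          using N by (simp add: e_def t(2) field_simps flip: exp_add)
        then have "f ?i powr (1 / p) * g ?j powr (1 / q) * e 1 N (?i' + ?j')
            = \<delta> * (f ?i powr (1 / p) * g ?j powr (1 / q)) * e 1 N (?i' + ?j' - int N)" by simp
        also have "\<dots> \<le> w (?i + ?j + 1) * e 1 N (?i' + ?j' - int N)"
          using w1[of ?i ?j] i j e_pos[of 1] by (intro mult_right_mono) (auto simp: less_imp_le)
        finally show ?thesis using le dm w1[of ?i ?j] i j by (simp add: F_def)
      qed
    qed (use sum_blocks(2) fin N in auto)
    then show ?thesis using sumF fin by simp
  qed
  define E where "E = (\<lambda>r. exp_mean (r * (- 2 * t)))"
  have lim: "(\<lambda>N. s r N / real N) \<longlonglongrightarrow> E r" for r
    using exp_mean_LIMSEQ[of "r * (- 2 * t)"] by (simp add: s_def E_def)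
  have E_pos: "0 < E r" for r by (simp add: E_def exp_mean_pos)
  have "sum f I * E p + sum g J * E q - 0 \<le> sum w K * E 1"
  proof (rule LIMSEQ_le)
    show "(\<lambda>N. sum f I * (s p N / real N) + sum g J * (s q N / real N) - 1 / real N)
        \<longlonglongrightarrow> sum f I * E p + sum g J * E q - 0"
      by (intro tendsto_intros lim lim_const_over_n)
    show "(\<lambda>N. sum w K * (s 1 N / real N)) \<longlonglongrightarrow> sum w K * E 1"
      by (intro tendsto_intros lim)
    show "\<exists>N0. \<forall>N\<ge>N0. sum f I * (s p N / real N) + sum g J * (s q N / real N) - 1 / real N
        \<le> sum w K * (s 1 N / real N)"
    proof (intro exI[of _ 1] allI impI)
      fix N :: nat assume "1 \<le> N"
      then show "sum f I * (s p N / real N) + sum g J * (s q N / real N) - 1 / real N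
          \<le> sum w K * (s 1 N / real N)"
        using divide_right_mono[OF block[of N], of "real N"]
        by (simp add: add_divide_distrib diff_divide_distrib)
    qed
  qed
  moreover have P: "0 < sum f I" and Q: "0 < sum g J"
    using f g fin by (auto intro: sum_pos2[of I a f] sum_pos2[of J b g])
  \<comment> \<open>Young's inequality is applied to \<open>p\<close> and \<open>q\<close> times the
    two summands: the weights \<open>1 / p\<close> and \<open>1 / q\<close> restore their sum, and
    \<open>p powr (1 / p) * q powr (1 / q)\<close> appears on the left.\<close>
  have "(p * (sum f I * E p)) powr (1 / p) * (q * (sum g J * E q)) powr (1 / q)
      \<le> 1 / p * (p * (sum f I * E p)) + 1 / q * (q * (sum g J * E q))"
    using pq P Q E_pos by (intro Youngs_inequality_0) auto
  moreover have "\<dots> = sum f I * E p + sum g J * E q" using pq by simp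
  ultimately have "(p * (sum f I * E p)) powr (1 / p) * (q * (sum g J * E q)) powr (1 / q) \<le> sum w K * E 1"
    by linarith
  then have *: "(p powr (1 / p) * q powr (1 / q)) * (sum f I powr (1 / p) * sum g J powr (1 / q))
      * (E p powr (1 / p) * E q powr (1 / q)) \<le> sum w K * E 1"
    using pq P Q E_pos[of p] E_pos[of q] by (simp add: powr_mult less_imp_le ac_simps)
  \<comment> \<open>This supplies the remaining factor \<open>(1 + \<delta>) / 2\<close>; the
    positive \<open>E 1\<close> cancels at the end.\<close>
  have "(1 + \<delta>) / 2 * E 1 \<le> E p powr (1 / p) * E q powr (1 / q)"
    using exp_mean_inequality[OF pq t(1)] by (simp add: E_def t(2))
  then have "(p powr (1 / p) * q powr (1 / q)) * (sum f I powr (1 / p) * sum g J powr (1 / q))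
      * ((1 + \<delta>) / 2 * E 1) \<le> sum w K * E 1"
    by (intro order_trans[OF mult_left_mono *]) auto
  then have "(p powr (1 / p) * q powr (1 / q) / 2 * (1 + \<delta>) *
      (sum f I powr (1 / p) * sum g J powr (1 / q))) * E 1 \<le> sum w K * E 1"
    by (simp add: ac_simps)
  then show ?thesis using E_pos[of 1] by simp
qed

text \<open>By homogeneity, dividing \<open>f\<close> and \<open>g\<close> by their positive maxima
  \<open>x\<close> and \<open>y\<close>, and \<open>w\<close> by
  \<open>z = x powr (1 / p) * y powr (1 / q)\<close>, reduces to the normalised case.\<close>

lemma weighted_prekopa_leindler:
  fixes f g w :: "int \<Rightarrow> real" and p q \<delta> :: real
  assumes pq: "1 < p" "1 < q" "1 / p + 1 / q = 1" and \<delta>: "0 < \<delta>" "\<delta> \<le> 1"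
    and fin: "finite I" "finite J" "finite K" and ne: "I \<noteq> {}" "J \<noteq> {}"
    and f: "\<And>i. i \<in> I \<Longrightarrow> 0 < f i" and g: "\<And>j. j \<in> J \<Longrightarrow> 0 < g j"
    and w: "\<And>k. k \<in> K \<Longrightarrow> 0 \<le> w k"
    and w0: "\<And>i j. i \<in> I \<Longrightarrow> j \<in> J \<Longrightarrow>
      i + j \<in> K \<and> f i powr (1 / p) * g j powr (1 / q) \<le> w (i + j)"
    and w1: "\<And>i j. i \<in> I \<Longrightarrow> j \<in> J \<Longrightarrow>
      i + j + 1 \<in> K \<and> \<delta> * (f i powr (1 / p) * g j powr (1 / q)) \<le> w (i + j + 1)"
  shows "p powr (1 / p) * q powr (1 / q) / 2 * (1 + \<delta>) *
      (sum f I powr (1 / p) * sum g J powr (1 / q)) \<le> sum w K"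
proof -
  define x where "x = Max (f ` I)"
  define y where "y = Max (g ` J)"
  have "x \<in> f ` I" "y \<in> g ` J" unfolding x_def y_def using fin ne by auto
  then obtain a b where ab: "a \<in> I" "f a = x" "b \<in> J" "g b = y" by auto
  have xy: "0 < x" "0 < y" using ab f g by auto
  have le: "f i \<le> x" if "i \<in> I" for i unfolding x_def using fin that by auto
  have le': "g j \<le> y" if "j \<in> J" for j unfolding y_def using fin that by auto
  define z where "z = x powr (1 / p) * y powr (1 / q)"
  have z: "0 < z" using xy by (simp add: z_def)
  have sc: "(u / x) powr (1 / p) * (v / y) powr (1 / q) = (u powr (1 / p) * v powr (1 / q)) / z"
    if "0 \<le> u" "0 \<le> v" for u v
    using that xy by (simp add: powr_divide z_def)
  have "p powr (1 / p) * q powr (1 / q) / 2 * (1 + \<delta>) *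
      ((\<Sum>i\<in>I. f i / x) powr (1 / p) * (\<Sum>j\<in>J. g j / y) powr (1 / q)) \<le> (\<Sum>k\<in>K. w k / z)"
  proof (rule weighted_prekopa_leindler_normalised[OF pq \<delta> fin])
    show "0 \<le> f i / x \<and> f i / x \<le> 1" if "i \<in> I" for i
      using le[OF that] f[OF that] xy by simp
    show "0 \<le> g i / y \<and> g i / y \<le> 1" if "i \<in> J" for i
      using le'[OF that] g[OF that] xy by simp
    fix i j assume ij: "i \<in> I" "j \<in> J"
    then have nn: "0 \<le> f i" "0 \<le> g j" using f g by (auto simp: less_imp_le)
    show "i + j \<in> K \<and> (f i / x) powr (1 / p) * (g j / y) powr (1 / q) \<le> w (i + j) / z"
      unfolding sc[OF nn] using w0[OF ij] z by (simp add: divide_right_mono)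
    show "i + j + 1 \<in> K \<and> \<delta> * ((f i / x) powr (1 / p) * (g j / y) powr (1 / q)) \<le> w (i + j + 1) / z"
      unfolding sc[OF nn] using w1[OF ij] z by (simp add: divide_right_mono)
  qed (use ab xy w z in auto)
  moreover have "0 \<le> sum f I" "0 \<le> sum g J" using f g by (auto intro!: sum_nonneg simp: less_imp_le)
  ultimately have "p powr (1 / p) * q powr (1 / q) / 2 * (1 + \<delta>) *
      (sum f I powr (1 / p) * sum g J powr (1 / q)) / z \<le> sum w K / z"
    by (simp only: sc sum_divide_distrib[symmetric] times_divide_eq_right)
  then show ?thesis using z by (simp only: divide_le_cancel)
qed

section \<open>Sumsets and subgroups\<close>

lemma finite_sumset: "finite A \<Longrightarrow> finite B \<Longrightarrow> finite (sumset A B)"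
proof -
  assume "finite A" "finite B"
  moreover have "sumset A B = (\<lambda>(a, b). a + b) ` (A \<times> B)" by (auto simp: sumset_def)
  ultimately show ?thesis by simp
qed

lemma sumset_mono: "A \<subseteq> A' \<Longrightarrow> B \<subseteq> B' \<Longrightarrow> sumset A B \<subseteq> sumset A' B'"
  by (auto simp: sumset_def)

lemma sumset_commute: "sumset A B = sumset B A"
  by (auto simp: sumset_def) (metis add.commute)+

lemma mem_sumset3E:
  assumes "t \<in> sumset (sumset A B) V"
  obtains a b v where "a \<in> A" "b \<in> B" "v \<in> V" "t = a + b + v"
  using assms by (auto simp: sumset_def)

lemma nsmul_0: "nsmul 0 x = 0" by (simp add: nsmul_def)

lemma nsmul_Suc: "nsmul (Suc n) x = x + nsmul n x" by (simp add: nsmul_def)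

lemma nsmul_minus: "nsmul n (- x) = - nsmul n x"
  by (induction n) (simp_all add: nsmul_0 nsmul_Suc)

section \<open>Integer multiples and levels modulo a subgroup\<close>

definition zmul :: "int \<Rightarrow> 'a::ab_group_add \<Rightarrow> 'a" where
  "zmul k x = (if 0 \<le> k then nsmul (nat k) x else - nsmul (nat (- k)) x)"

lemma zmul_plus_one: "zmul (k + 1) x = zmul k x + x"
proof -
  consider "0 \<le> k" | "k = -1" | "k < -1" by linarith
  then show ?thesis
  proof cases
    case 1
    then have "nat (k + 1) = Suc (nat k)" by simp
    with 1 show ?thesis by (simp add: zmul_def nsmul_Suc)
  next
    case 2
    then show ?thesis by (simp add: zmul_def nsmul_0 nsmul_Suc[of 0, simplified])
  next
    case 3
    then have "nat (- k) = Suc (nat (- (k + 1)))" by simp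
    with 3 show ?thesis by (simp add: zmul_def nsmul_Suc)
  qed
qed

lemma zmul_add: "zmul (j + k) x = zmul j x + zmul k x"
proof (induction k rule: int_induct[where k = 0])
  case base
  show ?case by (simp add: zmul_def nsmul_0)
next
  case (step1 i)
  then show ?case using zmul_plus_one[of "j + i" x] zmul_plus_one[of i x] by (simp add: ac_simps)
next
  case (step2 i)
  then show ?case
    using zmul_plus_one[of "j + i - 1" x] zmul_plus_one[of "i - 1" x] by (simp add: algebra_simps)
qed

lemma is_subgroup_closed:
  assumes "is_subgroup H"
  shows "0 \<in> H" "x \<in> H \<Longrightarrow> y \<in> H \<Longrightarrow> x - y \<in> H" "x \<in> H \<Longrightarrow> - x \<in> H"
    "x \<in> H \<Longrightarrow> y \<in> H \<Longrightarrow> x + y \<in> H"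
proof -
  show 0: "0 \<in> H" and d: "x \<in> H \<Longrightarrow> y \<in> H \<Longrightarrow> x - y \<in> H" for x y
    using assms by (auto simp: is_subgroup_def)
  show m: "x \<in> H \<Longrightarrow> - x \<in> H" for x using d[OF 0, of x] by simp
  show "x \<in> H \<Longrightarrow> y \<in> H \<Longrightarrow> x + y \<in> H" using d[of x "- y"] m[of y] by simp
qed

text \<open>Here \<^term>\<open>L\<close> is the subgroup generated by \<^term>\<open>H\<close> and \<^term>\<open>u\<close>, and
  \<^term>\<open>lev\<close> is the projection of \<^term>\<open>L\<close> onto its quotient by \<^term>\<open>H\<close>, an infinite cyclic
  group; its values outside \<^term>\<open>L\<close> are arbitrary.\<close>
lemma infinite_order_level:
  fixes H :: "'a::ab_group_add set"
  assumes H: "is_subgroup H" and u: "\<forall>n>0. nsmul n u \<notin> H"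
  obtains L and lev :: "'a \<Rightarrow> int" where "is_subgroup L"
    "\<And>x y. x \<in> L \<Longrightarrow> y \<in> L \<Longrightarrow> lev (x + y) = lev x + lev y"
    "\<And>h. h \<in> H \<Longrightarrow> h \<in> L \<and> lev h = 0" "u \<in> L" "lev u = 1"
proof -
  note closed = is_subgroup_closed[OF H]
  \<comment> \<open>Infinite order of \<open>u\<close> modulo \<open>H\<close> makes the
    \<open>k\<close> with \<open>x - zmul k u \<in> H\<close> unique, so the \<open>THE\<close> in
    \<open>lev\<close> is well defined on \<open>L\<close>.\<close>
  have zmul_notin: "k = 0" if "zmul k u \<in> H" for k
  proof (rule ccontr)
    assume "k \<noteq> 0"
    have "nsmul (nat \<bar>k\<bar>) u \<in> H"
      using that closed(3)[of "zmul k u"] by (auto simp: zmul_def abs_if split: if_splits)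
    with u \<open>k \<noteq> 0\<close> show False by simp
  qed
  have zmul_minus: "zmul (- k) u = - zmul k u" for k
    using zmul_add[of k "- k" u] by (simp add: zmul_def nsmul_0 eq_neg_iff_add_eq_0 add.commute)
  have zmul_diff: "zmul (j - k) u = zmul j u - zmul k u" for j k
    using zmul_add[of j "- k" u] zmul_minus[of k] by simp
  define L where "L = {x. \<exists>k. x - zmul k u \<in> H}"
  define lev where "lev = (\<lambda>x. THE k. x - zmul k u \<in> H)"
  have lev: "lev x = k" if "x - zmul k u \<in> H" for x k
    unfolding lev_def
  proof (rule the_equality[where P = "\<lambda>k. x - zmul k u \<in> H", OF that])
    fix j assume "x - zmul j u \<in> H"
    from closed(2)[OF that this] have "zmul (j - k) u \<in> H" by (simp add: zmul_diff)
    then show "j = k" using zmul_notin by fastforce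
  qed
  have inL: "x \<in> L" if "x - zmul k u \<in> H" for x k using that by (auto simp: L_def)
  have levL: "x - zmul (lev x) u \<in> H" if "x \<in> L" for x using that lev by (auto simp: L_def)
  have z0: "zmul 0 u = 0" "zmul 1 u = u"
    by (simp_all add: zmul_def nsmul_0 nsmul_Suc[of 0, simplified])
  show thesis
  proof
    show "is_subgroup L"
      unfolding is_subgroup_def
    proof (intro conjI ballI)
      show "0 \<in> L" using closed(1) by (intro inL[of _ 0]) (simp add: z0)
      fix x y assume "x \<in> L" "y \<in> L"
      from closed(2)[OF levL[OF this(1)] levL[OF this(2)]]
      have "x - y - zmul (lev x - lev y) u \<in> H" by (simp add: zmul_diff algebra_simps)
      then show "x - y \<in> L" by (rule inL)
    qed
    show "lev (x + y) = lev x + lev y" if "x \<in> L" "y \<in> L" for x y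
      using closed(4)[OF levL[OF that(1)] levL[OF that(2)]]
      by (intro lev) (simp add: zmul_add algebra_simps)
    show "h \<in> L \<and> lev h = 0" if "h \<in> H" for h
      using that inL[of h 0] lev[of h 0] by (simp add: z0)
    show "u \<in> L" "lev u = 1" using closed(1) inL[of u 1] lev[of u 1] by (simp_all add: z0)
  qed
qed

section \<open>Sumset bounds and their reduction to single cosets\<close>

lemma sum_card_fibres_le:
  assumes "finite T" "finite K"
  shows "(\<Sum>k\<in>K. card {t \<in> T. l t = k}) \<le> card T"
proof -
  have "(\<Sum>k\<in>K. card {t \<in> T. l t = k}) = card (\<Union>k\<in>K. {t \<in> T. l t = k})"
    using assms by (intro card_UN_disjoint[symmetric]) auto
  also have "\<dots> \<le> card T" using assms by (intro card_mono) auto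
  finally show ?thesis .
qed

lemma sum_card_fibres:
  assumes "finite T"
  shows "(\<Sum>k\<in>l ` T. card {t \<in> T. l t = k}) = card T"
  using sum.image_gen[OF assms, of "\<lambda>_. 1::nat" l] by simp

text \<open>For conjugate \<open>p\<close> and \<open>q\<close> this says that
  \<open>\<gamma>\<close> is a lower bound for \<open>beta p V\<close>, with infimum and division
  cleared away and \<open>A\<close>, \<open>B\<close> entering symmetrically.\<close>

definition sumset_bound :: "real \<Rightarrow> real \<Rightarrow> real \<Rightarrow> 'a::ab_group_add set \<Rightarrow> bool" where
  "sumset_bound p q \<gamma> V \<longleftrightarrow> (\<forall>A B. finite A \<longrightarrow> A \<noteq> {} \<longrightarrow> finite B \<longrightarrow> B \<noteq> {} \<longrightarrow>
     \<gamma> * (real (card A) powr (1 / p) * real (card B) powr (1 / q)) \<le> real (card (sumset (sumset A B) V)))"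

lemma sumset_bound_mono:
  fixes V :: "'a::ab_group_add set"
  assumes "sumset_bound p q \<gamma> V" "\<gamma>' \<le> \<gamma>"
  shows "sumset_bound p q \<gamma>' V"
  unfolding sumset_bound_def
proof (intro allI impI)
  fix A B :: "'a set"
  assume "finite A" "A \<noteq> {}" "finite B" "B \<noteq> {}"
  then have "\<gamma> * (real (card A) powr (1 / p) * real (card B) powr (1 / q)) \<le> real (card (sumset (sumset A B) V))"
    using assms(1) by (simp add: sumset_bound_def)
  moreover have "\<gamma>' * (real (card A) powr (1 / p) * real (card B) powr (1 / q))
      \<le> \<gamma> * (real (card A) powr (1 / p) * real (card B) powr (1 / q))"
    using assms(2) by (intro mult_right_mono) auto
  ultimately show "\<gamma>' * (real (card A) powr (1 / p) * real (card B) powr (1 / q))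
      \<le> real (card (sumset (sumset A B) V))"
    by (rule order_trans[rotated])
qed

text \<open>\<open>B\<close> and \<open>V\<close> each lie within one coset of \<open>L\<close>, so
  distinct classes of \<open>A\<close> modulo \<open>L\<close> give disjoint sumsets, whose sizes
  add up. A class of size \<open>m \<le> x\<close> has \<open>m powr \<alpha> = m * m powr (-
  \<alpha>') \<ge> m * x powr (- \<alpha>')\<close>, which is linear in \<open>m\<close> and sums
  over the classes to a multiple of \<open>card A\<close>.\<close>

lemma card_sumset_ge_cosetwise:
  fixes A B V L :: "'a::ab_group_add set" and \<alpha> \<alpha>' \<gamma> x y :: real
  assumes L: "is_subgroup L" and fin: "finite A" "finite B" "finite V"
    and B: "\<And>b b'. b \<in> B \<Longrightarrow> b' \<in> B \<Longrightarrow> b - b' \<in> L"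
    and V: "\<And>v v'. v \<in> V \<Longrightarrow> v' \<in> V \<Longrightarrow> v - v' \<in> L"
    and \<alpha>: "0 \<le> \<alpha>'" "\<alpha> + \<alpha>' = 1" and \<gamma>: "0 \<le> \<gamma>" "0 \<le> y"
    and x: "\<And>a. a \<in> A \<Longrightarrow> real (card {a' \<in> A. a' - a \<in> L}) \<le> x"
    and bound: "\<And>a. a \<in> A \<Longrightarrow> \<gamma> * (real (card {a' \<in> A. a' - a \<in> L}) powr \<alpha> * y)
      \<le> real (card (sumset (sumset {a' \<in> A. a' - a \<in> L} B) V))"
  shows "\<gamma> * (y * x powr (- \<alpha>') * real (card A)) \<le> real (card (sumset (sumset A B) V))"
proof -
  note closed = is_subgroup_closed[OF L]
  define cl where "cl = (\<lambda>a. {a'. a' - a \<in> L})"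
  have cl: "cl a' = cl a \<longleftrightarrow> a' - a \<in> L" for a a'
  proof
    assume "cl a' = cl a"
    moreover have "a' \<in> cl a'" using closed(1) by (simp add: cl_def)
    ultimately have "a' \<in> cl a" by simp
    then show "a' - a \<in> L" by (simp add: cl_def)
  next
    assume *: "a' - a \<in> L"
    have "z - a' \<in> L \<longleftrightarrow> z - a \<in> L" for z
      using closed(4)[OF _ *, of "z - a'"] closed(2)[OF _ *, of "z - a"] by auto
    then show "cl a' = cl a" by (auto simp: cl_def)
  qed
  define P where "P = (\<lambda>c. {a' \<in> A. cl a' = c})"
  define S where "S = (\<lambda>c. sumset (sumset (P c) B) V)"
  have P: "P (cl a) = {a' \<in> A. a' - a \<in> L}" for a by (simp add: P_def cl)
  have disj: "S c \<inter> S c' = {}" if "c \<noteq> c'" for c c'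
  proof (rule ccontr)
    assume "S c \<inter> S c' \<noteq> {}"
    then obtain t where "t \<in> S c" "t \<in> S c'" by auto
    then obtain a b v a' b' v' where "a \<in> P c" "b \<in> B" "v \<in> V" "t = a + b + v"
      "a' \<in> P c'" "b' \<in> B" "v' \<in> V" "t = a' + b' + v'"
      unfolding S_def by (auto elim!: mem_sumset3E)
    moreover from this have "a - a' = (b' - b) + (v' - v)" by (simp add: algebra_simps)
    ultimately have "a - a' \<in> L" using closed(4) B V by metis
    then have "cl a = cl a'" by (simp add: cl)
    with \<open>a \<in> P c\<close> \<open>a' \<in> P c'\<close> that show False by (simp add: P_def)
  qed
  have finP: "finite (P c)" for c using fin by (simp add: P_def)
  have finS: "finite (S c)" for c unfolding S_def using fin finP by (intro finite_sumset)
  have piece: "\<gamma> * (y * x powr (- \<alpha>') * real (card (P c))) \<le> real (card (S c))" if c: "c \<in> cl ` A" for c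
  proof -
    obtain a where a: "a \<in> A" "c = cl a" using c by auto
    then have "a \<in> P c" by (simp add: P_def)
    then have pos: "0 < real (card (P c))" using finP by (auto simp: card_gt_0_iff)
    have "x powr (- \<alpha>') \<le> real (card (P c)) powr (- \<alpha>')"
      using x[OF a(1)] a pos \<alpha> by (intro powr_mono2') (auto simp: P)
    then have "real (card (P c)) * x powr (- \<alpha>') \<le> real (card (P c)) powr 1 * real (card (P c)) powr (- \<alpha>')"
      using pos by (simp add: mult_left_mono)
    also have "\<dots> = real (card (P c)) powr \<alpha>"
    proof -
      have "\<alpha> = 1 + - \<alpha>'" using \<alpha> by simp
      then show ?thesis by (simp only: powr_add)
    qed
    finally have "\<gamma> * (real (card (P c)) * x powr (- \<alpha>') * y) \<le> \<gamma> * (real (card (P c)) powr \<alpha> * y)"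
      using \<gamma> by (intro mult_left_mono mult_right_mono)
    also have "\<dots> \<le> real (card (S c))" using bound[OF a(1)] a by (simp add: P S_def)
    finally show ?thesis by (simp add: ac_simps)
  qed
  have "\<gamma> * (y * x powr (- \<alpha>') * real (card A)) = (\<Sum>c\<in>cl ` A. \<gamma> * (y * x powr (- \<alpha>') * real (card (P c))))"
    using sum_card_fibres[OF fin(1), of cl] unfolding P_def
    by (simp add: sum_distrib_left[symmetric] flip: of_nat_sum)
  also have "\<dots> \<le> (\<Sum>c\<in>cl ` A. real (card (S c)))" by (intro sum_mono piece)
  also have "\<dots> = real (card (\<Union>c\<in>cl ` A. S c))"
    using fin finS disj by (subst card_UN_disjoint) auto
  also have "\<dots> \<le> real (card (sumset (sumset A B) V))"
    unfolding of_nat_le_iff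
  proof (rule card_mono)
    show "finite (sumset (sumset A B) V)" using fin by (intro finite_sumset)
    show "(\<Union>c\<in>cl ` A. S c) \<subseteq> sumset (sumset A B) V"
      unfolding S_def by (intro UN_least sumset_mono) (auto simp: P_def)
  qed
  finally show ?thesis .
qed

text \<open>Restricting one summand to its largest coset part gives two lower bounds, linear in
  \<^term>\<open>card A\<close> and in \<^term>\<open>card B\<close>; in their weighted geometric mean the sizes of the largest
  parts cancel.\<close>
lemma sumset_bound_from_cosets:
  fixes V L :: "'a::ab_group_add set" and p q \<gamma> :: real
  assumes pq: "1 < p" "1 < q" "1 / p + 1 / q = 1" and L: "is_subgroup L" and V: "finite V"
    "\<And>v v'. v \<in> V \<Longrightarrow> v' \<in> V \<Longrightarrow> v - v' \<in> L" and \<gamma>: "0 \<le> \<gamma>"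
    and bound: "\<And>A B. finite A \<Longrightarrow> A \<noteq> {} \<Longrightarrow> finite B \<Longrightarrow> B \<noteq> {} \<Longrightarrow>
      (\<And>a a'. a \<in> A \<Longrightarrow> a' \<in> A \<Longrightarrow> a - a' \<in> L) \<Longrightarrow> (\<And>b b'. b \<in> B \<Longrightarrow> b' \<in> B \<Longrightarrow> b - b' \<in> L) \<Longrightarrow>
      \<gamma> * (real (card A) powr (1 / p) * real (card B) powr (1 / q)) \<le> real (card (sumset (sumset A B) V))"
  shows "sumset_bound p q \<gamma> V"
  unfolding sumset_bound_def
proof (intro allI impI)
  fix A B :: "'a set"
  assume A: "finite A" "A \<noteq> {}" and B: "finite B" "B \<noteq> {}"
  note closed = is_subgroup_closed[OF L]
  define P where "P = (\<lambda>(A::'a set) a. {a' \<in> A. a' - a \<in> L})"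
  have P: "{a' \<in> A. a' - a \<in> L} = P A a" for A a by (simp add: P_def)
  have P_coset: "z - z' \<in> L" if "z \<in> P A a" "z' \<in> P A a" for A a z z'
    using closed(2)[of "z - a" "z' - a"] that by (simp add: P_def)
  have P_fin: "finite (P A a)" if "finite A" for A a using that by (simp add: P_def)
  have P_ne: "P A a \<noteq> {}" if "a \<in> A" for A a using that closed(1) by (auto simp: P_def)
  have ex: "\<exists>a\<in>A. \<forall>a'\<in>A. card (P A a') \<le> card (P A a)" if "finite A" "A \<noteq> {}" for A
    using obtains_MAX[OF that, of "\<lambda>a. card (P A a)"] that
    by (metis Max_ge finite_imageI imageI)
  obtain a where a: "a \<in> A" "\<And>a'. a' \<in> A \<Longrightarrow> card (P A a') \<le> card (P A a)" using ex[OF A] by blast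
  obtain b where b: "b \<in> B" "\<And>b'. b' \<in> B \<Longrightarrow> card (P B b') \<le> card (P B b)" using ex[OF B] by blast
  define x where "x = real (card (P A a))"
  define y where "y = real (card (P B b))"
  have xy: "0 < x" "0 < y"
    using P_ne a b P_fin A B by (auto simp: x_def y_def card_gt_0_iff)
  define T where "T = real (card (sumset (sumset A B) V))"
  have "\<gamma> * (y powr (1 / q) * x powr (- (1 / q)) * real (card A)) \<le> real (card (sumset (sumset A (P B b)) V))"
  proof (rule card_sumset_ge_cosetwise[OF L A(1) P_fin[OF B(1)] V(1) P_coset V(2) _ pq(3) \<gamma>],
      unfold P)
    show "real (card (P A a')) \<le> x" if "a' \<in> A" for a' using a that by (simp add: x_def)
    show "\<gamma> * (real (card (P A a')) powr (1 / p) * y powr (1 / q))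
        \<le> real (card (sumset (sumset (P A a') (P B b)) V))" if "a' \<in> A" for a'
      unfolding y_def by (intro bound P_fin P_ne P_coset A B b that)
  qed (use pq in auto)
  also have "\<dots> \<le> T"
    unfolding T_def of_nat_le_iff using A B V
    by (intro card_mono finite_sumset sumset_mono) (auto simp: P_def)
  finally have X: "\<gamma> * (y powr (1 / q) * x powr (- (1 / q)) * real (card A)) \<le> T" .
  have "\<gamma> * (x powr (1 / p) * y powr (- (1 / p)) * real (card B)) \<le> real (card (sumset (sumset B (P A a)) V))"
  proof (rule card_sumset_ge_cosetwise[OF L B(1) P_fin[OF A(1)] V(1) P_coset V(2) _ _ \<gamma>],
      unfold P)
    show "1 / q + 1 / p = 1" using pq by simp
    show "real (card (P B b')) \<le> y" if "b' \<in> B" for b' using b that by (simp add: y_def)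
    show "\<gamma> * (real (card (P B b')) powr (1 / q) * x powr (1 / p))
        \<le> real (card (sumset (sumset (P B b') (P A a)) V))" if "b' \<in> B" for b'
      unfolding x_def sumset_commute[of _ "P A a"] mult.commute[of "_ powr (1 / q)"]
      by (intro bound P_fin P_ne P_coset A B a that)
  qed (use pq in auto)
  also have "\<dots> \<le> T"
    unfolding T_def of_nat_le_iff sumset_commute[of A B] using A B V
    by (intro card_mono finite_sumset sumset_mono) (auto simp: P_def)
  finally have Y: "\<gamma> * (x powr (1 / p) * y powr (- (1 / p)) * real (card B)) \<le> T" .
  \<comment> \<open>The two bounds carry \<open>\<rho> powr (1 / q)\<close> and
    \<open>\<rho> powr (- (1 / p))\<close>; raised to the powers \<open>1 / p\<close> and
    \<open>1 / q\<close>, these have product 1.\<close>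
  define \<rho> where "\<rho> = y / x"
  have \<rho>: "0 < \<rho>" using xy by (simp add: \<rho>_def)
  have eqs: "y powr (1 / q) * x powr (- (1 / q)) = \<rho> powr (1 / q)"
    "x powr (1 / p) * y powr (- (1 / p)) = \<rho> powr (- (1 / p))"
    using xy by (simp_all add: \<rho>_def powr_divide powr_minus field_simps)
  have cancel: "(\<rho> powr (1 / q)) powr (1 / p) * (\<rho> powr (- (1 / p))) powr (1 / q) = 1"
    using \<rho> by (simp add: powr_powr mult.commute flip: powr_add)
  have \<gamma>1: "\<gamma> powr (1 / p) * \<gamma> powr (1 / q) = \<gamma>" using \<gamma> pq by (simp flip: powr_add)
  have T: "T powr (1 / p) * T powr (1 / q) = T" using pq by (simp add: T_def flip: powr_add)
  have "\<gamma> * (real (card A) powr (1 / p) * real (card B) powr (1 / q))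
      = (\<gamma> powr (1 / p) * \<gamma> powr (1 / q)) *
        ((\<rho> powr (1 / q)) powr (1 / p) * (\<rho> powr (- (1 / p))) powr (1 / q)) *
        (real (card A) powr (1 / p) * real (card B) powr (1 / q))"
    by (simp only: cancel \<gamma>1)
  also have "\<dots> = (\<gamma> * (\<rho> powr (1 / q) * real (card A))) powr (1 / p) *
      (\<gamma> * (\<rho> powr (- (1 / p)) * real (card B))) powr (1 / q)"
    using \<gamma> by (simp add: powr_mult)
  also have "\<dots> \<le> T powr (1 / p) * T powr (1 / q)"
    using X Y \<gamma> pq unfolding eqs by (intro mult_mono powr_mono2) auto
  finally show "\<gamma> * (real (card A) powr (1 / p) * real (card B) powr (1 / q)) \<le> real (card (sumset (sumset A B) V))"
    by (simp only: T) (simp only: T_def)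
qed

section \<open>Sets in two cosets whose difference has infinite order\<close>

text \<open>\<open>sumset_bound_from_cosets\<close> puts \<open>A\<close> and \<open>B\<close> into
  single cosets of \<open>L\<close>, so levels relative to base points add. Slices at levels
  \<open>i\<close> and \<open>j\<close> plus \<open>V0\<close> land at level \<open>i + j\<close>,
  plus \<open>V1\<close> at \<open>i + j + 1\<close>; dividing the slice bounds by
  \<open>\<gamma>0\<close> gives the hypotheses of \<open>weighted_prekopa_leindler\<close> with
  \<open>\<delta> = \<gamma>1 / \<gamma>0\<close>.\<close>

lemma sumset_bound_two_levels:
  fixes V0 V1 L :: "'a::ab_group_add set" and lev :: "'a \<Rightarrow> int" and p q \<gamma>0 \<gamma>1 :: real
  assumes pq: "1 < p" "1 < q" "1 / p + 1 / q = 1" and L: "is_subgroup L"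
    and lev: "\<And>x y. x \<in> L \<Longrightarrow> y \<in> L \<Longrightarrow> lev (x + y) = lev x + lev y"
    and V0: "finite V0" "\<And>v. v \<in> V0 \<Longrightarrow> v - x \<in> L \<and> lev (v - x) = 0"
    and V1: "finite V1" "\<And>v. v \<in> V1 \<Longrightarrow> v - x \<in> L \<and> lev (v - x) = 1"
    and bound: "sumset_bound p q \<gamma>0 V0" "sumset_bound p q \<gamma>1 V1" and \<gamma>: "0 < \<gamma>1" "\<gamma>1 \<le> \<gamma>0"
  shows "sumset_bound p q (p powr (1 / p) * q powr (1 / q) / 2 * (\<gamma>0 + \<gamma>1)) (V0 \<union> V1)"
proof (rule sumset_bound_from_cosets[OF pq L])
  let ?V = "V0 \<union> V1"
  note closed = is_subgroup_closed[OF L]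
  show "finite ?V" using V0 V1 by simp
  show "v - v' \<in> L" if "v \<in> ?V" "v' \<in> ?V" for v v'
    using closed(2)[of "v - x" "v' - x"] that V0 V1 by auto
  show "0 \<le> p powr (1 / p) * q powr (1 / q) / 2 * (\<gamma>0 + \<gamma>1)" using \<gamma> by simp
  fix A B :: "'a set"
  assume A: "finite A" "A \<noteq> {}" and B: "finite B" "B \<noteq> {}"
    and AL: "\<And>a a'. a \<in> A \<Longrightarrow> a' \<in> A \<Longrightarrow> a - a' \<in> L" and BL: "\<And>b b'. b \<in> B \<Longrightarrow> b' \<in> B \<Longrightarrow> b - b' \<in> L"
  obtain a0 b0 where 0: "a0 \<in> A" "b0 \<in> B" using A B by auto
  define I where "I = (\<lambda>a. lev (a - a0)) ` A"
  define J where "J = (\<lambda>b. lev (b - b0)) ` B"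
  define As where "As = (\<lambda>i. {a \<in> A. lev (a - a0) = i})"
  define Bs where "Bs = (\<lambda>j. {b \<in> B. lev (b - b0) = j})"
  define T where "T = sumset (sumset A B) ?V"
  define Ts where "Ts = (\<lambda>k. {t \<in> T. lev (t - (a0 + b0 + x)) = k})"
  \<comment> \<open>The first part collects the levels reached through \<open>V0\<close>, the second
    those reached through \<open>V1\<close>.\<close>
  define K where "K = (\<lambda>(i, j). i + j) ` (I \<times> J) \<union> (\<lambda>(i, j). i + j + 1) ` (I \<times> J)"
  define \<delta> where "\<delta> = \<gamma>1 / \<gamma>0"
  have finT: "finite T" unfolding T_def using A B V0 V1 by (intro finite_sumset) auto
  have lev_sum: "lev (a + b + v - (a0 + b0 + x)) = lev (a - a0) + lev (b - b0) + lev (v - x)"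
    if "a \<in> A" "b \<in> B" "v \<in> ?V" for a b v
  proof -
    have m: "a - a0 \<in> L" "b - b0 \<in> L" "v - x \<in> L" using AL BL 0 that V0 V1 by auto
    have "a + b + v - (a0 + b0 + x) = (a - a0) + (b - b0) + (v - x)" by (simp add: algebra_simps)
    then show ?thesis using m closed(4)[OF m(1,2)] by (simp only: lev)
  qed
  \<comment> \<open>Used twice: with \<open>e = 0\<close> for \<open>V0\<close> and with
    \<open>e = 1\<close> for \<open>V1\<close>.\<close>
  have slice: "\<gamma>' * (real (card (As i)) powr (1 / p) * real (card (Bs j)) powr (1 / q)) \<le> real (card (Ts (i + j + e)))"
    if ij: "i \<in> I" "j \<in> J" and V': "V' \<subseteq> ?V" "\<And>v. v \<in> V' \<Longrightarrow> lev (v - x) = e"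
      and b: "sumset_bound p q \<gamma>' V'" for i j e V' \<gamma>'
  proof -
    have "As i \<noteq> {}" "Bs j \<noteq> {}" "finite (As i)" "finite (Bs j)"
      using ij A B by (auto simp: As_def Bs_def I_def J_def)
    then have "\<gamma>' * (real (card (As i)) powr (1 / p) * real (card (Bs j)) powr (1 / q))
        \<le> real (card (sumset (sumset (As i) (Bs j)) V'))"
      using b unfolding sumset_bound_def by blast
    also have "\<dots> \<le> real (card (Ts (i + j + e)))"
      unfolding of_nat_le_iff
    proof (rule card_mono)
      show "finite (Ts (i + j + e))" using finT by (simp add: Ts_def)
      show "sumset (sumset (As i) (Bs j)) V' \<subseteq> Ts (i + j + e)"
      proof
        fix t assume "t \<in> sumset (sumset (As i) (Bs j)) V'"
        then obtain a b v where t: "a \<in> As i" "b \<in> Bs j" "v \<in> V'" "t = a + b + v"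
          by (rule mem_sumset3E)
        then have "a \<in> A" "b \<in> B" "v \<in> ?V" using V' by (auto simp: As_def Bs_def)
        moreover from this have "t \<in> T" unfolding T_def sumset_def t(4) by blast
        ultimately show "t \<in> Ts (i + j + e)"
          using lev_sum[of a b v] t V' by (simp add: Ts_def As_def Bs_def)
      qed
    qed
    finally show ?thesis .
  qed
  have \<gamma>0: "0 < \<gamma>0" using \<gamma> by simp
  have "p powr (1 / p) * q powr (1 / q) / 2 * (1 + \<delta>) *
      ((\<Sum>i\<in>I. real (card (As i))) powr (1 / p) * (\<Sum>j\<in>J. real (card (Bs j))) powr (1 / q))
      \<le> (\<Sum>k\<in>K. real (card (Ts k)) / \<gamma>0)"
  proof (rule weighted_prekopa_leindler[OF pq])
    show "0 < \<delta>" "\<delta> \<le> 1" using \<gamma> by (auto simp: \<delta>_def)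
    show "finite I" "finite J" "finite K" "I \<noteq> {}" "J \<noteq> {}" using A B by (auto simp: I_def J_def K_def)
    show "0 < real (card (As i))" if "i \<in> I" for i
      using that A by (auto simp: As_def I_def card_gt_0_iff)
    show "0 < real (card (Bs i))" if "i \<in> J" for i
      using that B by (auto simp: Bs_def J_def card_gt_0_iff)
    show "0 \<le> real (card (Ts k)) / \<gamma>0" for k using \<gamma>0 by simp
    fix i j assume ij: "i \<in> I" "j \<in> J"
    have "i + j \<in> K" "i + j + 1 \<in> K" using ij by (auto simp: K_def)
    then show "i + j \<in> K \<and> real (card (As i)) powr (1 / p) * real (card (Bs j)) powr (1 / q)
        \<le> real (card (Ts (i + j))) / \<gamma>0"
      and "i + j + 1 \<in> K \<and> \<delta> * (real (card (As i)) powr (1 / p) * real (card (Bs j)) powr (1 / q))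
        \<le> real (card (Ts (i + j + 1))) / \<gamma>0"
      using slice[OF ij _ _ bound(1), of 0] slice[OF ij _ _ bound(2), of 1] V0 V1 \<gamma>0
      by (simp_all add: \<delta>_def field_simps)
  qed
  also have "(\<Sum>i\<in>I. real (card (As i))) = real (card A)"
    using sum_card_fibres[OF A(1)] unfolding I_def As_def by (simp flip: of_nat_sum)
  also have "(\<Sum>j\<in>J. real (card (Bs j))) = real (card B)"
    using sum_card_fibres[OF B(1)] unfolding J_def Bs_def by (simp flip: of_nat_sum)
  also have "(\<Sum>k\<in>K. real (card (Ts k)) / \<gamma>0) = real (\<Sum>k\<in>K. card (Ts k)) / \<gamma>0"
    by (simp add: sum_divide_distrib)
  also have "\<dots> \<le> real (card T) / \<gamma>0"
  proof -
    have "finite K" using A B by (auto simp: I_def J_def K_def)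
    from sum_card_fibres_le[OF finT this] have "(\<Sum>k\<in>K. card (Ts k)) \<le> card T" unfolding Ts_def .
    then show ?thesis using \<gamma>0 by (intro divide_right_mono of_nat_mono) auto
  qed
  finally have "\<gamma>0 * (p powr (1 / p) * q powr (1 / q) / 2 * (1 + \<delta>) *
      (real (card A) powr (1 / p) * real (card B) powr (1 / q))) \<le> real (card T)"
    using \<gamma>0 by (simp add: field_simps)
  moreover have "\<gamma>0 + \<gamma>1 = \<gamma>0 * (1 + \<delta>)" using \<gamma>0 by (simp add: \<delta>_def field_simps)
  ultimately show "p powr (1 / p) * q powr (1 / q) / 2 * (\<gamma>0 + \<gamma>1) *
      (real (card A) powr (1 / p) * real (card B) powr (1 / q)) \<le> real (card (sumset (sumset A B) ?V))"
    unfolding T_def by (simp only: ac_simps)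
qed

text \<open>\<open>sumset_bound_two_levels\<close> wants the larger constant at level 0. If it
  belongs to the coset of \<open>y\<close>, the cosets are swapped, replacing \<open>y - x\<close>
  by \<open>x - y\<close>; both have infinite order modulo \<open>H\<close>.\<close>

lemma sumset_bound_two_cosets:
  fixes V0 V1 H :: "'a::ab_group_add set" and p q \<gamma>0 \<gamma>1 :: real
  assumes pq: "1 < p" "1 < q" "1 / p + 1 / q = 1" and H: "is_subgroup H"
    and ord: "\<forall>n>0. nsmul n (x - y) \<notin> H"
    and V0: "finite V0" "V0 \<subseteq> coset H x" and V1: "finite V1" "V1 \<subseteq> coset H y"
    and bound: "sumset_bound p q \<gamma>0 V0" "sumset_bound p q \<gamma>1 V1" and \<gamma>: "0 < \<gamma>0" "0 < \<gamma>1"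
  shows "sumset_bound p q (p powr (1 / p) * q powr (1 / q) / 2 * (\<gamma>0 + \<gamma>1)) (V0 \<union> V1)"
proof -
  have ord': "\<forall>n>0. nsmul n (y - x) \<notin> H"
  proof (intro allI impI notI)
    fix n :: nat assume "0 < n" "nsmul n (y - x) \<in> H"
    then show False
      using ord is_subgroup_closed(3)[OF H] nsmul_minus[of n "y - x"] by (metis minus_diff_eq)
  qed
  have le: "sumset_bound p q (p powr (1 / p) * q powr (1 / q) / 2 * (\<gamma>0 + \<gamma>1)) (V0 \<union> V1)"
    if V: "finite V0" "V0 \<subseteq> coset H x" "finite V1" "V1 \<subseteq> coset H y"
      and o: "\<forall>n>0. nsmul n (y - x) \<notin> H"
      and b: "sumset_bound p q \<gamma>0 V0" "sumset_bound p q \<gamma>1 V1" "0 < \<gamma>1" "\<gamma>1 \<le> \<gamma>0"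
    for V0 V1 x y \<gamma>0 \<gamma>1
  proof -
    obtain L and lev :: "'a \<Rightarrow> int" where L: "is_subgroup L"
      and lev: "\<And>x y. x \<in> L \<Longrightarrow> y \<in> L \<Longrightarrow> lev (x + y) = lev x + lev y"
        "\<And>h. h \<in> H \<Longrightarrow> h \<in> L \<and> lev h = 0" "y - x \<in> L" "lev (y - x) = 1"
      using infinite_order_level[OF H o] by blast
    show ?thesis
    proof (rule sumset_bound_two_levels[OF pq L lev(1) V(1) _ V(3) _ b])
      show "v - x \<in> L \<and> lev (v - x) = 0" if "v \<in> V0" for v
        using that V(2) lev(2) by (auto simp: coset_def)
      show "v - x \<in> L \<and> lev (v - x) = 1" if "v \<in> V1" for v
      proof -
        have h: "v - y \<in> L \<and> lev (v - y) = 0" using that V(4) lev(2) by (auto simp: coset_def)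
        have "(v - y) + (y - x) \<in> L" "lev ((v - y) + (y - x)) = 1"
          using h lev(1)[of "v - y" "y - x"] lev(3,4) is_subgroup_closed(4)[OF L, of "v - y" "y - x"]
          by auto
        then show ?thesis by simp
      qed
    qed
  qed
  show ?thesis
  proof (cases "\<gamma>1 \<le> \<gamma>0")
    case True
    then show ?thesis using le[OF V0 V1 ord' bound] \<gamma> by simp
  next
    case False
    then show ?thesis
      using le[OF V1 V0 ord bound(2,1)] \<gamma> by (simp add: Un_commute add.commute)
  qed
qed

section \<open>Induction over quasicubes\<close>

lemma finite_quasicube: "quasicube d U \<Longrightarrow> finite U"
proof (induction rule: quasicube.induct)
  case (step H x y U d)
  then have "U = (U \<inter> coset H x) \<union> (U \<inter> coset H y)" by auto
  then show ?case using step by (metis finite_UnI)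
qed simp

lemma sumset_bound_empty: "sumset_bound p q 0 {}"
  by (simp add: sumset_bound_def)

text \<open>The sumset contains a translate of \<open>A\<close> and one of \<open>B\<close>, so its
  size dominates both cardinalities and hence their weighted geometric mean.\<close>

lemma sumset_bound_singleton:
  fixes z :: "'a::ab_group_add"
  assumes "1 < p" "1 < q" "1 / p + 1 / q = 1"
  shows "sumset_bound p q 1 {z}"
  unfolding sumset_bound_def
proof (intro allI impI)
  fix A B :: "'a set"
  assume A: "finite A" "A \<noteq> {}" and B: "finite B" "B \<noteq> {}"
  obtain a b where ab: "a \<in> A" "b \<in> B" using A B by auto
  let ?T = "sumset (sumset A B) {z}"
  have T: "finite ?T" using A B by (intro finite_sumset) auto
  have "card ((\<lambda>a. a + b + z) ` A) \<le> card ?T" "card ((\<lambda>b. a + b + z) ` B) \<le> card ?T"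
    using ab by (intro card_mono[OF T]; auto simp: sumset_def)+
  moreover have "card ((\<lambda>a. a + b + z) ` A) = card A" "card ((\<lambda>b. a + b + z) ` B) = card B"
    by (auto intro!: card_image inj_onI)
  ultimately have "real (card A) powr (1 / p) * real (card B) powr (1 / q)
      \<le> real (card ?T) powr (1 / p) * real (card ?T) powr (1 / q)"
    using assms by (intro mult_mono powr_mono2) auto
  also have "\<dots> = real (card ?T)" using assms by (simp flip: powr_add)
  finally show "1 * (real (card A) powr (1 / p) * real (card B) powr (1 / q)) \<le> real (card ?T)" by simp
qed

text \<open>Young's inequality at \<open>p\<close> and \<open>q\<close> with weights
  \<open>1 / p\<close> and \<open>1 / q\<close>: the arithmetic mean is
  \<open>1 + 1 = 2\<close>.\<close>

lemma weighted_constant_le_1: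
  fixes p q :: real
  assumes "1 < p" "1 < q" "1 / p + 1 / q = 1"
  shows "p powr (1 / p) * q powr (1 / q) / 2 \<le> 1"
  using Youngs_inequality_0[of "1 / p" "1 / q" p q] assms by simp

text \<open>The induction covers all subsets \<open>V\<close> at once, so that it applies to the
  traces of \<open>V\<close> on both cosets.\<close>

lemma sumset_bound_quasicube:
  fixes U V :: "'a::ab_group_add set" and p q :: real
  assumes pq: "1 < p" "1 < q" "1 / p + 1 / q = 1" and "quasicube d U" "V \<subseteq> U"
  shows "sumset_bound p q ((p powr (1 / p) * q powr (1 / q) / 2) ^ d * real (card V)) V"
  using assms(4,5)
proof (induction arbitrary: V rule: quasicube.induct)
  case (zero z)
  then consider "V = {}" | "V = {z}" by auto
  then show ?case using sumset_bound_empty sumset_bound_singleton[OF pq] by cases auto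
next
  case (step H x y U d)
  define c where "c = p powr (1 / p) * q powr (1 / q) / 2"
  have c: "0 < c" "c \<le> 1" using weighted_constant_le_1[OF pq] pq by (auto simp: c_def)
  define V0 where "V0 = V \<inter> coset H x"
  define V1 where "V1 = V \<inter> coset H y"
  have V: "V = V0 \<union> V1" using step by (auto simp: V0_def V1_def)
  have fin: "finite V0" "finite V1"
    using finite_quasicube[OF step.hyps(5)] finite_quasicube[OF step.hyps(6)] step.prems
    unfolding V0_def V1_def by (meson Int_mono finite_subset order_refl)+
  have IH: "sumset_bound p q (c ^ d * real (card V0)) V0" "sumset_bound p q (c ^ d * real (card V1)) V1"
    using step.IH(1)[of V0] step.IH(2)[of V1] step.prems by (auto simp: c_def V0_def V1_def)
  have shrink: "c ^ Suc d * m \<le> c ^ d * m" if "0 \<le> m" for m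
    using c that by (intro mult_right_mono power_decreasing) auto
  have "sumset_bound p q (c ^ Suc d * real (card V)) V"
  proof (cases "V0 = {} \<or> V1 = {}")
    \<comment> \<open>\<open>V\<close> lies in one coset: the bound for dimension \<open>d\<close>
      carries over, and \<open>c \<le> 1\<close> absorbs the extra factor.\<close>
    case True
    then have "sumset_bound p q (c ^ d * real (card V)) V" using V IH by auto
    then show ?thesis using shrink by (rule sumset_bound_mono) simp
  next
    case False
    \<comment> \<open>Both traces are nonempty, so their constants are positive, as
      \<open>sumset_bound_two_cosets\<close> demands.\<close>
    then have "0 < c ^ d * real (card V0)" "0 < c ^ d * real (card V1)"
      using fin c by (auto simp: card_gt_0_iff)
    then have *: "sumset_bound p q (c * (c ^ d * real (card V0) + c ^ d * real (card V1))) V"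
      unfolding V c_def
      by (intro sumset_bound_two_cosets[OF pq step.hyps(1) step.hyps(7) fin(1) _ fin(2) _ IH[unfolded c_def]])
        (auto simp: V0_def V1_def c_def)
    have "real (card V) \<le> real (card V0) + real (card V1)" unfolding V using card_Un_le[of V0 V1] by linarith
    then have "c ^ Suc d * real (card V) \<le> c ^ Suc d * (real (card V0) + real (card V1))"
      using c by (intro mult_left_mono) auto
    then show ?thesis by (intro sumset_bound_mono[OF *]) (simp add: algebra_simps)
  qed
  then show ?case by (simp only: c_def)
qed

theorem mainTheorem2:
  fixes p q :: real and U V :: "'a::ab_group_add set" and d :: nat
  assumes "1 < p" and "1 / p + 1 / q = 1"
    and "quasicube d U" and "V \<subseteq> U"
  shows "p powr (1 / p) * q powr (1 / q) / 2 \<le> 1 \<and>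
         beta p V \<ge> (p powr (1 / p) * q powr (1 / q) / 2) ^ d * real (card V)"
proof
  \<comment> \<open>Identifies the exponent \<open>1 - 1 / p\<close> in \<open>beta\<close> with
    \<open>1 / q\<close>; it also yields \<open>1 < q\<close>.\<close>
  have q_inv: "1 / q = 1 - 1 / p" using assms(2) by simp
  have "0 < 1 / q" "1 / q < 1" using assms(1) unfolding q_inv by auto
  then have q: "1 < q" by (simp add: divide_less_eq split: if_splits)
  show "p powr (1 / p) * q powr (1 / q) / 2 \<le> 1"
    using weighted_constant_le_1 assms q by blast
  have bound: "sumset_bound p q ((p powr (1 / p) * q powr (1 / q) / 2) ^ d * real (card V)) V"
    using sumset_bound_quasicube assms q by blast
  show "(p powr (1 / p) * q powr (1 / q) / 2) ^ d * real (card V) \<le> beta p V"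
    unfolding beta_def
  \<comment> \<open>The infimum of a nonempty set is at least any common lower bound; after clearing
    the positive denominator, the required bound on each quotient is \<open>bound\<close>.\<close>
  proof (rule cInf_greatest)
    show "{real (card (sumset (sumset A B) V)) /
        (real (card A) powr (1 / p) * real (card B) powr (1 - 1 / p)) | A B.
        finite A \<and> A \<noteq> {} \<and> finite B \<and> B \<noteq> {}} \<noteq> {}"
      by blast
    fix z assume "z \<in> {real (card (sumset (sumset A B) V)) /
        (real (card A) powr (1 / p) * real (card B) powr (1 - 1 / p)) | A B.
        finite A \<and> A \<noteq> {} \<and> finite B \<and> B \<noteq> {}}"
    then obtain A B where AB: "finite A" "A \<noteq> {}" "finite B" "B \<noteq> {}"
      and z: "z = real (card (sumset (sumset A B) V)) / (real (card A) powr (1 / p) * real (card B) powr (1 / q))"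
      unfolding q_inv by blast
    have "0 < real (card A) powr (1 / p) * real (card B) powr (1 / q)" using AB by (simp add: card_gt_0_iff)
    then show "(p powr (1 / p) * q powr (1 / q) / 2) ^ d * real (card V) \<le> z"
      unfolding z using bound AB by (subst pos_le_divide_eq) (auto simp: sumset_bound_def)
  qed
qed

end
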